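(* Let $f_1,\dots,f_n:\mathbb{R}^d\to\mathbb{R}$ be twice continuously differentiable and let $\mu,L>0$ be constants such that $\mu I\preceq\nabla^2 f_{\mathcal S}(x)\preceq LI$ for all $x\in\mathbb{R}^d$ and all nonempty $\mathcal S\subset[n]$. Let $h:\mathbb{R}^d\to\mathbb{R}\cup\{+\infty\}$ be proper, convex and lower semicontinuous, let $F=\frac1n\sum_{i=1}^nf_i+h$, let $x^*$ be the unique minimizer of $F$ and $F^*=F(x^* )$. Let $\{x_k\},\{w_k\}$ be generated by the proximal loopless SVRG algorithm described in the context with probability parameter $p\in(0,1)$ and constant step size $\eta_k\equiv\eta$ satisfying $$0<\eta\le\min\left\{\frac1L,\ \frac{2}{18L+2\mu}\right\}.$$ Define $\phi_k:=\|x_k-x^*\|^2+\frac{10L}{p}\eta^2[F(w_k)-F^*]+2\eta[F(x_k)-F^*]$. Then for all $k\ge0$, $$\mathbb{E}[\phi_k]\le\max\left\{1-\eta\mu,\ 1-\frac p5\right\}^k\phi_0 .$$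
   Context: Notation: $[n]=\{1,\dots,n\}$; $f=\frac1n\sum_{i=1}^nf_i$; $f_{\mathcal S}=\frac1{|\mathcal S|}\sum_{i\in\mathcal S}f_i$ for nonempty $\mathcal S\subset[n]$; $\mathrm{prox}_{\eta,h}(x)=\arg\min_{z\in\mathbb{R}^d}\{h(z)+\frac1{2\eta}\|z-x\|^2\}$; $\mathbb{E}$ is expectation over all randomness of the algorithm. Proximal loopless SVRG: start from deterministic $x_0=w_0\in\mathbb{R}^d$. For $k=0,1,\dots$: sample $i_k$ uniformly at random from $[n]$; set $v_k=\nabla f_{i_k}(x_k)-\nabla f_{i_k}(w_k)+\nabla f(w_k)$; set $x_{k+1}=\mathrm{prox}_{\eta_k,h}(x_k-\eta_kv_k)$; set $w_{k+1}=x_k$ with probability $p$ and $w_{k+1}=w_k$ with probability $1-p$. All random choices are independent. *)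

theory Defs
  imports "HOL-Analysis.Analysis" "HOL-Probability.Probability"
begin

subsection \<open>Smooth functions\<close>

definition grad :: "('a::real_inner \<Rightarrow> real) \<Rightarrow> 'a \<Rightarrow> 'a" where
  "grad f x = (THE g. GDERIV f x :> g)"

definition hessian :: "(real^'d \<Rightarrow> real) \<Rightarrow> real^'d \<Rightarrow> real^'d^'d" where
  "hessian f x = jacobian (grad f) (at x)"

definition twice_cont_differentiable :: "(real^'d \<Rightarrow> real) \<Rightarrow> bool" where
  "twice_cont_differentiable f \<longleftrightarrow>
     (\<forall>x. f differentiable (at x)) \<and> (\<forall>x. grad f differentiable (at x)) \<and>
     continuous_on UNIV (hessian f)"

definition pos_semidef :: "real^'d^'d \<Rightarrow> bool" where
  "pos_semidef A \<longleftrightarrow> transpose A = A \<and> (\<forall>v. 0 \<le> v \<bullet> (A *v v))"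

definition loewner_le :: "real^'d^'d \<Rightarrow> real^'d^'d \<Rightarrow> bool"  (infix \<open>\<preceq>\<close> 50) where
  "A \<preceq> B \<longleftrightarrow> pos_semidef (B - A)"

definition avg :: "(nat \<Rightarrow> 'a \<Rightarrow> real) \<Rightarrow> nat set \<Rightarrow> 'a \<Rightarrow> real" where
  "avg f S x = (\<Sum>i\<in>S. f i x) / real (card S)"

subsection \<open>Extended-real-valued functions\<close>

definition proper_fun :: "('a \<Rightarrow> ereal) \<Rightarrow> bool" where
  "proper_fun h \<longleftrightarrow> (\<forall>x. h x \<noteq> -\<infinity>) \<and> (\<exists>x. h x \<noteq> \<infinity>)"

definition convex_fun :: "('a::real_vector \<Rightarrow> ereal) \<Rightarrow> bool" where
  "convex_fun h \<longleftrightarrow>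
     (\<forall>x y. \<forall>t\<in>{0<..<1::real}.
        h ((1 - t) *\<^sub>R x + t *\<^sub>R y) \<le> ereal (1 - t) * h x + ereal t * h y)"

definition lower_semicont :: "('a::topological_space \<Rightarrow> ereal) \<Rightarrow> bool" where
  "lower_semicont h \<longleftrightarrow> (\<forall>x. h x \<le> Liminf (at x) h)"

definition unique_minimizer :: "('a \<Rightarrow> ereal) \<Rightarrow> 'a \<Rightarrow> bool" where
  "unique_minimizer F x \<longleftrightarrow>
     is_arg_min F (\<lambda>_. True) x \<and> (\<forall>y. is_arg_min F (\<lambda>_. True) y \<longrightarrow> y = x)"

definition prox :: "real \<Rightarrow> ('a::real_normed_vector \<Rightarrow> ereal) \<Rightarrow> 'a \<Rightarrow> 'a" where
  "prox \<eta> h x = arg_min (\<lambda>z. h z + ereal (1 / (2 * \<eta>) * (norm (z - x))\<^sup>2)) (\<lambda>_. True)"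

definition objective ::
  "nat \<Rightarrow> (nat \<Rightarrow> 'a \<Rightarrow> real) \<Rightarrow> ('a \<Rightarrow> ereal) \<Rightarrow> 'a \<Rightarrow> ereal" where
  "objective n f h x = ereal (avg f {1..n} x) + h x"

subsection \<open>Proximal loopless SVRG\<close>

text \<open>The pair \<open>(x\<^sub>k, w\<^sub>k)\<close> along one realization \<open>is\<close> of the sampled indices and \<open>bs\<close> of the
  coins, where \<open>bs k\<close> says that the reference point is refreshed in iteration \<open>k\<close>.\<close>

primrec lsvrg ::
  "nat \<Rightarrow> (nat \<Rightarrow> 'a::real_inner \<Rightarrow> real) \<Rightarrow> ('a \<Rightarrow> ereal) \<Rightarrow> (nat \<Rightarrow> real) \<Rightarrow> 'a \<Rightarrow>
   (nat \<Rightarrow> nat) \<Rightarrow> (nat \<Rightarrow> bool) \<Rightarrow> nat \<Rightarrow> 'a \<times> 'a" where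
  "lsvrg n f h \<eta> x0 is bs 0 = (x0, x0)"
| "lsvrg n f h \<eta> x0 is bs (Suc k) =
     (let (x, w) = lsvrg n f h \<eta> x0 is bs k;
          v = grad (f (is k)) x - grad (f (is k)) w + grad (avg f {1..n}) w
      in (prox (\<eta> k) h (x - \<eta> k *\<^sub>R v), if bs k then x else w))"

text \<open>The whole family of indices and coins is mutually independent; the sum type only serves to
  put index-valued and coin-valued variables into one family.\<close>

definition lsvrg_randomness ::
  "'s measure \<Rightarrow> nat \<Rightarrow> real \<Rightarrow> (nat \<Rightarrow> 's \<Rightarrow> nat) \<Rightarrow> (nat \<Rightarrow> 's \<Rightarrow> bool) \<Rightarrow> bool" where
  "lsvrg_randomness M n p I B \<longleftrightarrow>
     prob_space M \<and>
     prob_space.indep_vars M (\<lambda>_. count_space UNIV)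
       (case_sum (\<lambda>k \<omega>. Inl (I k \<omega>)) (\<lambda>k \<omega>. Inr (B k \<omega>))) (UNIV :: (nat + nat) set) \<and>
     (\<forall>k. distr M (count_space UNIV) (I k) = measure_pmf (pmf_of_set {1..n})) \<and>
     (\<forall>k. distr M (count_space UNIV) (B k) = measure_pmf (bernoulli_pmf p))"

text \<open>Expectation of a nonnegative extended-real-valued random variable (negative values would be
  truncated to \<open>0\<close>). It may be \<open>\<infinity>\<close>, as happens for the Lyapunov function below when the starting
  point is outside the domain of \<open>h\<close>.\<close>

definition expect :: "'s measure \<Rightarrow> ('s \<Rightarrow> ereal) \<Rightarrow> ereal" where
  "expect M Z = enn2ereal (\<integral>\<^sup>+ \<omega>. e2ennreal (Z \<omega>) \<partial>M)"

text \<open>Here \<open>x\<^sub>s\<close> is the minimizer of \<open>F\<close>, so that \<open>F x\<^sub>s\<close> is the optimal value, which makes both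
  bracketed differences nonnegative.\<close>

definition lyapunov ::
  "('a::real_normed_vector \<Rightarrow> ereal) \<Rightarrow> 'a \<Rightarrow> real \<Rightarrow> real \<Rightarrow> real \<Rightarrow> 'a \<times> 'a \<Rightarrow> ereal" where
  "lyapunov F x\<^sub>s L p \<eta> = (\<lambda>(x, w).
     ereal ((norm (x - x\<^sub>s))\<^sup>2) + ereal (10 * L / p * \<eta>\<^sup>2) * (F w - F x\<^sub>s)
       + ereal (2 * \<eta>) * (F x - F x\<^sub>s))"

end

theory Submission
  imports Defs
begin

text \<open>The proof is a Lyapunov argument. Write \<open>D\<close> for the optimality gap of the objective, let \<open>e\<close> be the
difference between the stochastic gradient estimator and the true gradient at \<open>x\<close>, and let \<open>x'\<close> be the
next iterate. Smoothness, strong convexity and the variational inequality of the proximal point give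
(\<open>prox_gradient_descent\<close>)

  \<open>(norm (x' - xs))\<^sup>2 + 2 * \<eta> * D x' \<le> (1 - \<eta> * \<mu>) * (norm (x - xs))\<^sup>2 - 2 * \<eta> * (e \<bullet> (x' - xs))\<close>.

The estimator is unbiased, but \<open>x'\<close> depends on the sample. Comparing \<open>x'\<close> with the proximal point of the
exact gradient step, which is deterministic, and using that the proximal map is nonexpansive, the last
term contributes on average at most \<open>2 * \<eta>\<^sup>2\<close> times the mean of \<open>(norm e)\<^sup>2\<close> (\<open>prox_step_mean\<close>). The
variance is controlled by the gaps themselves: cocoercivity of the gradients and the optimality
condition at the minimizer bound it by \<open>4 * L * (D x + D w)\<close> (\<open>estimator_variance\<close>). The term in \<open>D w\<close> is
compensated by the coin, which replaces \<open>D w\<close> by \<open>D x\<close> with probability \<open>p\<close>. The weights of the Lyapunov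
function are chosen so that all coefficients contract (\<open>potential_contraction\<close>).

Two points lie outside this computation. The proximal map is a choice of minimizer, so that a
minimizer has to exist. The optimality condition at \<open>xs\<close> gives \<open>h\<close> an affine minorant, hence the proximal
objective is coercive, and lower semicontinuity does the rest (\<open>prox_is_arg_min\<close>). Further, the
one-step bound has to be integrated over the independent samples. The state is a function of the
list of earlier samples, which has a countable type, and the current index and coin are independent
of that list (\<open>nn_integral_next_sample\<close>).\<close>

section \<open>Gradients and quadratic bounds\<close>

lemma GDERIV_grad:
  fixes f :: "'a::euclidean_space \<Rightarrow> real"
  assumes "GDERIV f x :> g"
  shows "grad f x = g"
  unfolding grad_def
proof (rule the_equality)
  fix g' assume "GDERIV f x :> g'"
  then have "(\<lambda>v. v \<bullet> g') = (\<lambda>v. v \<bullet> g)"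
    using assms has_derivative_unique unfolding gderiv_def by blast
  then show "g' = g"
    by (metis vector_eq_ldot)
qed (fact assms)

lemma differentiable_GDERIV_grad:
  fixes f :: "'a::euclidean_space \<Rightarrow> real"
  assumes "f differentiable (at x)"
  shows "GDERIV f x :> grad f x"
proof -
  obtain f' where f': "(f has_derivative f') (at x)"
    using assms by (auto simp: differentiable_def)
  have "f' = (\<lambda>v. v \<bullet> adjoint f' 1)"
    using adjoint_works[OF has_derivative_linear[OF f'], of _ 1] by auto
  then have "GDERIV f x :> adjoint f' 1"
    using f' by (simp add: gderiv_def)
  then show ?thesis
    using GDERIV_grad by metis
qed

lemma quadratic_form_bounds:
  fixes A :: "real^'d^'d"
  assumes "mat \<mu> \<preceq> A" and "A \<preceq> mat L"
  shows "\<mu> * (norm v)\<^sup>2 \<le> v \<bullet> (A *v v)" and "v \<bullet> (A *v v) \<le> L * (norm v)\<^sup>2"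
proof -
  have mat: "mat c *v v = c *\<^sub>R v" for c :: real
    by (simp add: vec_eq_iff matrix_vector_mult_def mat_def if_distrib[of "\<lambda>a. a * _"] cong: if_cong)
  show "\<mu> * (norm v)\<^sup>2 \<le> v \<bullet> (A *v v)" "v \<bullet> (A *v v) \<le> L * (norm v)\<^sup>2"
    using assms unfolding loewner_le_def pos_semidef_def
    by (auto simp: matrix_vector_mult_diff_rdistrib inner_diff_right mat power2_norm_eq_inner dest!: spec[of _ v])
qed

text \<open>Along the line through \<open>x\<close> and \<open>y\<close> the function has the Hessian form as second derivative, so this
is Taylor's theorem in one variable with the Lagrange remainder. Bounds on the Hessian become
quadratic upper and lower bounds on \<open>f\<close>.\<close>

lemma second_order_expansion:
  fixes f :: "real^'d \<Rightarrow> real"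
  assumes "twice_cont_differentiable f"
  obtains z where "f y - f x - (y - x) \<bullet> grad f x = (y - x) \<bullet> (hessian f z *v (y - x)) / 2"
proof -
  define v where "v = y - x"
  have line: "((\<lambda>t. x + t *\<^sub>R v) has_derivative (\<lambda>s. s *\<^sub>R v)) (at t)" for t :: real
    by (auto intro!: derivative_eq_intros)
  have f1: "((\<lambda>t. f (x + t *\<^sub>R v)) has_real_derivative v \<bullet> grad f (x + t *\<^sub>R v)) (at t)" for t
  proof -
    have "(f has_derivative (\<lambda>u. u \<bullet> grad f (x + t *\<^sub>R v))) (at (x + t *\<^sub>R v))"
      using assms differentiable_GDERIV_grad[of f]
      by (auto simp: twice_cont_differentiable_def gderiv_def)
    from has_derivative_compose[OF line this] show ?thesis
      by (simp add: has_field_derivative_def mult_commute_abs)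
  qed
  have f2: "((\<lambda>t. v \<bullet> grad f (x + t *\<^sub>R v)) has_real_derivative
      v \<bullet> (hessian f (x + t *\<^sub>R v) *v v)) (at t)" for t
  proof -
    have "(grad f has_derivative (\<lambda>u. hessian f (x + t *\<^sub>R v) *v u)) (at (x + t *\<^sub>R v))"
      using assms by (simp add: twice_cont_differentiable_def hessian_def jacobian_works)
    from has_derivative_inner_right[OF has_derivative_compose[OF line this]] show ?thesis
      by (simp add: has_field_derivative_def matrix_vector_mult_scaleR mult_commute_abs)
  qed
  define diff where "diff = (\<lambda>(m::nat) t. if m = 0 then f (x + t *\<^sub>R v)
     else if m = 1 then v \<bullet> grad f (x + t *\<^sub>R v) else v \<bullet> (hessian f (x + t *\<^sub>R v) *v v))"
  have "\<exists>t>0. t < 1 \<and> f (x + 1 *\<^sub>R v) =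
      (\<Sum>m<2. (diff m 0 / fact m) * (1 - 0)^m) + (diff 2 t / fact 2) * (1 - 0)^2"
  proof (rule Taylor_up[where a = 0])
    show "\<forall>m t. m < 2 \<and> 0 \<le> t \<and> t \<le> 1 \<longrightarrow> (diff m has_real_derivative diff (Suc m) t) (at t)"
      using f1 f2 by (auto simp: diff_def less_2_cases_iff)
  qed (auto simp: diff_def)
  then obtain t where "f (x + v) = f x + v \<bullet> grad f x + v \<bullet> (hessian f (x + t *\<^sub>R v) *v v) / 2"
    by (auto simp: diff_def numeral_2_eq_2)
  then show ?thesis
    using that[of "x + t *\<^sub>R v"] by (simp add: v_def)
qed

text \<open>Subtracting the linear function with slope \<open>g y\<close> turns \<open>y\<close> into a global minimizer. One gradient step
of length \<open>1 / L\<close> from \<open>x\<close> decreases the tilted function by at least \<open>(norm (g x - g y))\<^sup>2 / (2 * L)\<close>, yet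
it cannot get below the value at \<open>y\<close>.\<close>

lemma gradient_cocoercive:
  fixes f :: "'a::real_inner \<Rightarrow> real"
  assumes "L > 0"
    and lower: "\<And>x y. 0 \<le> f y - f x - (y - x) \<bullet> g x"
    and upper: "\<And>x y. f y - f x - (y - x) \<bullet> g x \<le> L / 2 * (norm (y - x))\<^sup>2"
  shows "(norm (g x - g y))\<^sup>2 \<le> 2 * L * (f x - f y - (x - y) \<bullet> g y)"
proof -
  define d where "d = g x - g y"
  define z where "z = x - (1 / L) *\<^sub>R d"
  have "0 \<le> f z - f y - (z - y) \<bullet> g y"
    by (rule lower)
  moreover have "f z - f x - (z - x) \<bullet> g x \<le> (norm d)\<^sup>2 / (2 * L)"
    using upper[of z x] \<open>L > 0\<close> by (simp add: z_def power_divide power2_eq_square field_simps)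
  moreover have "(z - y) \<bullet> g y - (z - x) \<bullet> g x = (x - y) \<bullet> g y + (norm d)\<^sup>2 / L"
    using \<open>L > 0\<close> unfolding z_def d_def
    by (simp add: power2_norm_eq_inner inner_simps field_simps inner_commute)
  ultimately have "(norm d)\<^sup>2 / (2 * L) \<le> f x - f y - (x - y) \<bullet> g y"
    by (simp add: field_simps)
  then show ?thesis
    using \<open>L > 0\<close> by (simp add: d_def field_simps)
qed

section \<open>Convex functions and the proximal map\<close>

text \<open>Compare \<open>z\<close> with a point that has moved by a small fraction \<open>t\<close> towards \<open>u\<close>. Convexity bounds the
change of \<open>h\<close> by \<open>t * (h u - h z)\<close>, minimality bounds it from below by the change of \<open>q\<close>; divide by \<open>t\<close> and
let \<open>t\<close> tend to 0. With \<open>q\<close> the smooth part of the objective this is the optimality condition of the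
problem; with \<open>q\<close> a squared distance it characterizes the proximal map.\<close>

lemma subgradient_at_minimizer:
  fixes h :: "'a::euclidean_space \<Rightarrow> ereal"
  assumes h: "proper_fun h" "convex_fun h"
    and min: "is_arg_min (\<lambda>z. h z + ereal (q z)) (\<lambda>_. True) z"
    and q: "GDERIV q z :> g"
  shows "h z \<noteq> \<infinity>" and "h u \<ge> h z + ereal ((z - u) \<bullet> g)"
proof -
  have le: "h z + ereal (q z) \<le> h y + ereal (q y)" for y
    using min by (auto simp: is_arg_min_def not_less)
  have nm: "h y \<noteq> -\<infinity>" for y
    using h by (auto simp: proper_fun_def)
  show fin: "h z \<noteq> \<infinity>"
    using h(1) le by (force simp: proper_fun_def)
  then obtain a where a: "h z = ereal a"
    using nm[of z] by (cases "h z") auto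
  show "h u \<ge> h z + ereal ((z - u) \<bullet> g)"
  proof (cases "h u")
    case (real b)
    define l where "l = (\<lambda>t::real. z + t *\<^sub>R (u - z))"
    have bound: "a - b \<le> (q (l t) - q z) / t" if "0 < t" "t < 1" for t
    proof -
      have "h (l t) \<le> ereal ((1 - t) * a + t * b)"
        proof -
        have "l t = (1 - t) *\<^sub>R z + t *\<^sub>R u"
          by (simp add: l_def algebra_simps)
        then have "h (l t) \<le> ereal (1 - t) * h z + ereal t * h u"
          using h(2) that by (simp add: convex_fun_def)
        then show ?thesis
          by (simp add: a real)
      qed
      then have "h (l t) + ereal (q (l t)) \<le> ereal ((1 - t) * a + t * b) + ereal (q (l t))"
        by (rule add_right_mono)
      with le[of "l t"] have "ereal (a + q z) \<le> ereal ((1 - t) * a + t * b + q (l t))"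
        using order.trans by (fastforce simp: a)
      then show ?thesis
        using that by (simp add: field_simps)
    qed
    have "((\<lambda>t. q (l t)) has_real_derivative (u - z) \<bullet> g) (at 0)"
    proof -
      have "(l has_derivative (\<lambda>s. s *\<^sub>R (u - z))) (at 0)"
        unfolding l_def by (auto intro!: derivative_eq_intros)
      moreover have "(q has_derivative (\<lambda>v. v \<bullet> g)) (at (l 0))"
        using q by (simp add: gderiv_def l_def)
      ultimately have "((\<lambda>t. q (l t)) has_derivative (\<lambda>s. (s *\<^sub>R (u - z)) \<bullet> g)) (at 0)"
        by (rule has_derivative_compose)
      then show ?thesis
        by (simp add: has_field_derivative_def mult_commute_abs)
    qed
    then have "((\<lambda>t. (q (l t) - q z) / t) \<longlongrightarrow> (u - z) \<bullet> g) (at_right 0)"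
      unfolding DERIV_def by (auto simp: l_def intro: filterlim_mono at_le)
    moreover have "eventually (\<lambda>t. a - b \<le> (q (l t) - q z) / t) (at_right 0)"
      using eventually_at_right_real[OF zero_less_one] by eventually_elim (auto intro: bound)
    ultimately have "a - b \<le> (u - z) \<bullet> g"
      by (intro tendsto_lowerbound) auto
    then show ?thesis
      by (simp add: a real inner_diff_left)
  qed (use nm[of u] in auto)
qed

text \<open>If no point were minimal, the open sets \<open>{z. G u < G z}\<close> with \<open>u\<close> in \<open>C\<close> would cover \<open>C\<close>. Among the
finitely many centres of a subcover take one with the least value: it lies in one of the sets, whose
centre then has a still smaller value.\<close>

lemma lower_semicont_attains_min:
  fixes G :: "'a::topological_space \<Rightarrow> ereal"
  assumes "compact C" "C \<noteq> {}"
    and lsc: "\<And>z c. c < G z \<Longrightarrow> eventually (\<lambda>u. c < G u) (nhds z)"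
  shows "\<exists>z\<in>C. \<forall>u\<in>C. G z \<le> G u"
proof (rule ccontr)
  assume "\<not> ?thesis"
  then have "\<forall>z\<in>C. \<exists>u\<in>C. G u < G z"
    by (auto simp: not_le)
  then have "C \<subseteq> (\<Union>u\<in>C. {z. G u < G z})"
    by auto
  moreover have "open {z. G u < G z}" for u
    using lsc[of "G u"] by (subst open_subopen) (metis eventually_nhds mem_Collect_eq subsetI)
  ultimately obtain T where T: "T \<subseteq> C" "finite T" "C \<subseteq> (\<Union>u\<in>T. {z. G u < G z})"
    using compactE_image[OF \<open>compact C\<close>, of C "\<lambda>u. {z. G u < G z}"] by metis
  have "T \<noteq> {}"
    using T \<open>C \<noteq> {}\<close> by auto
  have "Min (G ` T) \<in> G ` T"
    using T \<open>T \<noteq> {}\<close> by (intro Min_in) auto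
  then obtain t where t: "t \<in> T" "G t = Min (G ` T)"
    by auto
  then obtain u where "u \<in> T" "G u < G t"
    using T by blast
  then show False
    using t T by (metis Min_le finite_imageI imageI not_le)
qed

lemma lower_semicont_add_continuous:
  fixes h :: "'a::t2_space \<Rightarrow> ereal" and q :: "'a \<Rightarrow> real"
  assumes "proper_fun h" and "lower_semicont h" and "continuous_on UNIV q"
    and c: "c < h z + ereal (q z)"
  shows "eventually (\<lambda>u. c < h u + ereal (q u)) (nhds z)"
proof (cases c)
  case (real r)
  have "ereal (r - q z) < h z"
    using c real by (cases "h z") auto
  then obtain s where s: "ereal (r - q z) < ereal s" "ereal s < h z"
    using ereal_dense2 by blast
  have "eventually (\<lambda>u. ereal s < h u) (at z)"
    using assms(2) s(2) by (intro less_LiminfD) (auto simp: lower_semicont_def intro: less_le_trans)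
  then have 1: "eventually (\<lambda>u. ereal s < h u) (nhds z)"
    using s(2) by (simp add: eventually_nhds_conv_at)
  have "(q \<longlongrightarrow> q z) (nhds z)"
    using assms(3) by (simp add: continuous_on_eq_continuous_at isCont_def tendsto_at_iff_tendsto_nhds)
  then have 2: "eventually (\<lambda>u. r - s < q u) (nhds z)"
    using s(1) by (intro order_tendstoD) auto
  from 1 2 show ?thesis
    unfolding real
  proof eventually_elim
    case (elim u)
    then show ?case by (cases "h u") auto
  qed
next
  case MInf
  then show ?thesis
    using assms(1) by (auto simp: proper_fun_def intro!: always_eventually)
qed (use c in auto)

text \<open>The proximal map is a choice of minimizer, hence meaningful only once a minimizer exists. The affine
minorant makes the objective exceed its value at some point \<open>z0\<close> everywhere outside a ball, and on
the ball lower semicontinuity applies.\<close>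

lemma prox_is_arg_min:
  fixes h :: "'a::euclidean_space \<Rightarrow> ereal"
  assumes "proper_fun h" and "lower_semicont h" and "\<eta> > 0"
    and minorant: "\<And>u. ereal (a + b \<bullet> u) \<le> h u"
  shows "is_arg_min (\<lambda>z. h z + ereal (1 / (2 * \<eta>) * (norm (z - y))\<^sup>2)) (\<lambda>_. True) (prox \<eta> h y)"
proof -
  define q where "q = (\<lambda>z. 1 / (2 * \<eta>) * (norm (z - y))\<^sup>2)"
  define G where "G = (\<lambda>z. h z + ereal (q z))"
  obtain z0 c where z0: "G z0 = ereal c"
  proof -
    obtain z0 where "h z0 \<noteq> \<infinity>" "h z0 \<noteq> -\<infinity>"
      using assms(1) by (auto simp: proper_fun_def)
    then show ?thesis using that[of z0]
      by (cases "h z0") (auto simp: G_def)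
  qed
  define K where "K = \<bar>c - a - b \<bullet> y\<bar> + 1"
  \<comment> \<open>The radius beyond which the quadratic term outweighs the slope of the minorant and the level \<open>c\<close>.\<close>
  define R where "R = max 1 (max (norm (z0 - y)) (2 * \<eta> * (norm b + K)))"
  have far: "ereal c < G z" if "norm (z - y) > R" for z
  proof -
    define r where "r = norm (z - y)"
    have r: "1 < r" "2 * \<eta> * (norm b + K) < r"
      using that by (auto simp: r_def R_def)
    have "K \<ge> 1"
      by (simp add: K_def)
    have "norm b + K < r / (2 * \<eta>)"
      using r(2) \<open>\<eta> > 0\<close> by (simp add: field_simps)
    then have "r * (norm b + K) \<le> r * (r / (2 * \<eta>))"
      using r(1) by (intro mult_left_mono) auto
    moreover have "K \<le> r * K"
      using r(1) \<open>K \<ge> 1\<close> by simp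
    ultimately have "K \<le> r\<^sup>2 / (2 * \<eta>) - norm b * r"
      by (simp add: algebra_simps power2_eq_square)
    moreover have "b \<bullet> (z - y) \<ge> - (norm b * r)"
      using norm_cauchy_schwarz[of b "y - z"] by (simp add: r_def norm_minus_commute inner_diff_right)
    ultimately have "c < a + b \<bullet> z + q z"
      by (simp add: K_def q_def r_def inner_diff_right)
    moreover have "ereal (a + b \<bullet> z) + ereal (q z) \<le> G z"
      unfolding G_def by (intro add_right_mono minorant)
    ultimately show ?thesis
      by (auto elim!: less_le_trans[rotated])
  qed
  have "\<exists>z\<in>cball y R. \<forall>u\<in>cball y R. G z \<le> G u"
  proof (rule lower_semicont_attains_min)
    show "cball y R \<noteq> {}"
      by (simp add: R_def)
    show "eventually (\<lambda>u. c < G u) (nhds z)" if "c < G z" for c z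
      using that unfolding G_def
      by (intro lower_semicont_add_continuous assms)
        (use \<open>\<eta> > 0\<close> in \<open>auto simp: q_def intro!: continuous_intros\<close>)
  qed auto
  then obtain z where z: "\<And>u. u \<in> cball y R \<Longrightarrow> G z \<le> G u"
    by blast
  have "z0 \<in> cball y R"
    by (simp add: R_def dist_norm norm_minus_commute)
  have "G z \<le> G u" for u
  proof (cases "u \<in> cball y R")
    case False
    then have "G z0 \<le> G u"
      using far[of u] by (simp add: z0 dist_norm norm_minus_commute)
    then show ?thesis
      using z[OF \<open>z0 \<in> cball y R\<close>] by simp
  qed (fact z)
  then have "is_arg_min G (\<lambda>_. True) z"
    by (auto simp: is_arg_min_def not_less)
  then show ?thesis
    unfolding prox_def arg_min_def q_def G_def by (rule someI)
qed

lemma prox_subgradient: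
  fixes h :: "'a::euclidean_space \<Rightarrow> ereal"
  assumes "proper_fun h" "convex_fun h"
    and min: "is_arg_min (\<lambda>z. h z + ereal (1 / (2 * \<eta>) * (norm (z - y))\<^sup>2)) (\<lambda>_. True) z"
    and "\<eta> > 0"
  shows "h z \<noteq> \<infinity>" and "h u \<ge> h z + ereal ((y - z) \<bullet> (u - z) / \<eta>)"
proof -
  have g: "GDERIV (\<lambda>z. 1 / (2 * \<eta>) * (norm (z - y))\<^sup>2) z :> (1 / \<eta>) *\<^sub>R (z - y)"
    unfolding gderiv_def power2_norm_eq_inner using \<open>\<eta> > 0\<close>
    by (auto intro!: derivative_eq_intros simp: inner_commute)
  note sub = subgradient_at_minimizer[OF assms(1-3) g]
  show "h z \<noteq> \<infinity>"
    by (rule sub)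
  have "(z - u) \<bullet> ((1 / \<eta>) *\<^sub>R (z - y)) = (y - z) \<bullet> (u - z) / \<eta>"
    using \<open>\<eta> > 0\<close> by (simp add: field_simps inner_simps inner_commute)
  then show "h u \<ge> h z + ereal ((y - z) \<bullet> (u - z) / \<eta>)"
    using sub(2)[of u] by metis
qed

section \<open>One step of the algorithm\<close>

text \<open>Of the Hessian bounds the convergence argument uses two consequences for each summand, the quadratic
lower bound (strong convexity) and the quadratic upper bound (smoothness).\<close>

locale smooth_finite_sum =
  fixes n :: nat and f :: "nat \<Rightarrow> 'a::euclidean_space \<Rightarrow> real" and h :: "'a \<Rightarrow> ereal"
    and \<mu> L :: real and xs :: 'a
  assumes n: "n \<ge> 1" and mu: "0 \<le> \<mu>" and L: "0 < L"
    and deriv: "\<And>i x. i \<in> {1..n} \<Longrightarrow> GDERIV (f i) x :> grad (f i) x"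
    and lower: "\<And>i x y. i \<in> {1..n} \<Longrightarrow> \<mu> / 2 * (norm (y - x))\<^sup>2 \<le> f i y - f i x - (y - x) \<bullet> grad (f i) x"
    and upper: "\<And>i x y. i \<in> {1..n} \<Longrightarrow> f i y - f i x - (y - x) \<bullet> grad (f i) x \<le> L / 2 * (norm (y - x))\<^sup>2"
    and proper: "proper_fun h" and convex: "convex_fun h" and lsc: "lower_semicont h"
    and minimizer: "is_arg_min (objective n f h) (\<lambda>_. True) xs"
begin

definition smooth_part :: "'a \<Rightarrow> real" where
  "smooth_part = avg f {1..n}"

definition estimator :: "nat \<Rightarrow> 'a \<Rightarrow> 'a \<Rightarrow> 'a" where
  "estimator i x w = grad (f i) x - grad (f i) w + grad smooth_part w"

text \<open>The optimality gap as a real number. It is meaningful on the domain of \<open>h\<close> only, because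
\<open>real_of_ereal\<close> sends infinity to 0; iterates that start in that domain stay there.\<close>

definition gap :: "'a \<Rightarrow> real" where
  "gap x = smooth_part x + real_of_ereal (h x) - smooth_part xs - real_of_ereal (h xs)"

lemma GDERIV_smooth_part: "GDERIV smooth_part x :> (1 / real n) *\<^sub>R (\<Sum>i=1..n. grad (f i) x)"
proof -
  have "((\<lambda>x. \<Sum>i=1..n. f i x) has_derivative (\<lambda>v. \<Sum>i=1..n. v \<bullet> grad (f i) x)) (at x)"
    using deriv by (intro has_derivative_sum) (auto simp: gderiv_def)
  from has_derivative_mult_right[OF this, of "1 / real n"] show ?thesis
    by (simp add: gderiv_def smooth_part_def avg_def[abs_def] inner_sum_right)
qed

lemma grad_smooth_part: "grad smooth_part x = (1 / real n) *\<^sub>R (\<Sum>i=1..n. grad (f i) x)"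
  by (rule GDERIV_grad[OF GDERIV_smooth_part])

lemma smooth_part_expansion:
  "smooth_part y - smooth_part x - (y - x) \<bullet> grad smooth_part x =
     (\<Sum>i=1..n. f i y - f i x - (y - x) \<bullet> grad (f i) x) / real n"
  unfolding grad_smooth_part
  by (simp add: smooth_part_def avg_def sum_subtractf inner_sum_right diff_divide_distrib)

lemma smooth_part_lower:
  "\<mu> / 2 * (norm (y - x))\<^sup>2 \<le> smooth_part y - smooth_part x - (y - x) \<bullet> grad smooth_part x"
proof -
  have "(\<Sum>i=1..n. \<mu> / 2 * (norm (y - x))\<^sup>2) \<le> (\<Sum>i=1..n. f i y - f i x - (y - x) \<bullet> grad (f i) x)"
    by (intro sum_mono lower)
  then show ?thesis
    unfolding smooth_part_expansion using n by (simp add: pos_le_divide_eq pos_divide_le_eq mult.commute)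
qed

lemma smooth_part_upper:
  "smooth_part y - smooth_part x - (y - x) \<bullet> grad smooth_part x \<le> L / 2 * (norm (y - x))\<^sup>2"
proof -
  have "(\<Sum>i=1..n. f i y - f i x - (y - x) \<bullet> grad (f i) x) \<le> (\<Sum>i=1..n. L / 2 * (norm (y - x))\<^sup>2)"
    by (intro sum_mono upper)
  then show ?thesis
    unfolding smooth_part_expansion using n by (simp add: pos_le_divide_eq pos_divide_le_eq mult.commute)
qed

lemma ereal_h: "h z \<noteq> \<infinity> \<Longrightarrow> h z = ereal (real_of_ereal (h z))"
  using proper by (cases "h z") (auto simp: proper_fun_def)

lemma optimality:
  shows "h xs \<noteq> \<infinity>" and "h u \<ge> h xs + ereal ((xs - u) \<bullet> grad smooth_part xs)"
proof -
  have "is_arg_min (\<lambda>z. h z + ereal (smooth_part z)) (\<lambda>_. True) xs"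
    using minimizer by (simp add: objective_def[abs_def] smooth_part_def add.commute)
  note sub = subgradient_at_minimizer[OF proper convex this GDERIV_smooth_part]
  show "h xs \<noteq> \<infinity>" "h u \<ge> h xs + ereal ((xs - u) \<bullet> grad smooth_part xs)"
    using sub by (auto simp: grad_smooth_part)
qed

lemma objective_gap: "h x \<noteq> \<infinity> \<Longrightarrow> objective n f h x - objective n f h xs = ereal (gap x)"
  using ereal_h[of x] ereal_h[OF optimality(1)]
  by (cases "h x"; cases "h xs") (auto simp: objective_def smooth_part_def gap_def)

text \<open>The negative gradient of the smooth part at the minimizer is a subgradient of \<open>h\<close> there, so the linear
term is absorbed by the difference of the values of \<open>h\<close>.\<close>

lemma smooth_gap_le_gap:
  assumes "h x \<noteq> \<infinity>"
  shows "smooth_part x - smooth_part xs - (x - xs) \<bullet> grad smooth_part xs \<le> gap x"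
  using optimality(2)[of x] ereal_h[OF assms] ereal_h[OF optimality(1)]
  by (cases "h x"; cases "h xs") (auto simp: gap_def inner_diff_left)

lemma gap_nonneg: "h x \<noteq> \<infinity> \<Longrightarrow> 0 \<le> gap x"
  using smooth_gap_le_gap[of x] smooth_part_lower[of x xs] mu
  by (smt (verit) divide_nonneg_nonneg mult_nonneg_nonneg zero_le_power2)

text \<open>The optimality condition at the minimizer provides the affine minorant of \<open>h\<close> that guarantees
the existence of proximal points.\<close>

lemma prox_minimizes:
  assumes "\<eta> > 0"
  shows "is_arg_min (\<lambda>z. h z + ereal (1 / (2 * \<eta>) * (norm (z - y))\<^sup>2)) (\<lambda>_. True) (prox \<eta> h y)"
proof (rule prox_is_arg_min[OF proper lsc assms])
  fix u
  show "ereal (real_of_ereal (h xs) + xs \<bullet> grad smooth_part xs + (- grad smooth_part xs) \<bullet> u) \<le> h u"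
    using optimality(2)[of u] ereal_h[OF optimality(1)]
    by (cases "h xs") (auto simp: inner_diff_left inner_commute algebra_simps)
qed

lemma prox_finite: "\<eta> > 0 \<Longrightarrow> h (prox \<eta> h y) \<noteq> \<infinity>"
  using prox_subgradient(1)[OF proper convex prox_minimizes] .

lemma prox_variational:
  assumes "\<eta> > 0" and "h u \<noteq> \<infinity>"
  shows "real_of_ereal (h (prox \<eta> h y)) + (y - prox \<eta> h y) \<bullet> (u - prox \<eta> h y) / \<eta> \<le> real_of_ereal (h u)"
  using prox_subgradient(2)[OF proper convex prox_minimizes, of \<eta> y u] assms
    ereal_h[OF assms(2)] ereal_h[OF prox_finite[OF assms(1), of y]]
  by (metis ereal_less_eq(3) plus_ereal.simps(1))

text \<open>Add the variational inequalities of the two proximal points, each tested at the other point, and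
use the Cauchy-Schwarz inequality.\<close>

lemma prox_nonexpansive:
  assumes "\<eta> > 0"
  shows "norm (prox \<eta> h y - prox \<eta> h y') \<le> norm (y - y')"
proof -
  let ?z = "prox \<eta> h y" and ?z' = "prox \<eta> h y'"
  have "(y - ?z) \<bullet> (?z' - ?z) / \<eta> + (y' - ?z') \<bullet> (?z - ?z') / \<eta> \<le> 0"
    using prox_variational[OF assms prox_finite[OF assms], of y y']
      prox_variational[OF assms prox_finite[OF assms], of y' y] by simp
  then have "(y - ?z) \<bullet> (?z' - ?z) + (y' - ?z') \<bullet> (?z - ?z') \<le> 0"
    using assms by (simp add: field_simps)
  moreover have "(norm (?z - ?z'))\<^sup>2 =
      (y - ?z) \<bullet> (?z' - ?z) + (y' - ?z') \<bullet> (?z - ?z') + (y - y') \<bullet> (?z - ?z')"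
    by (simp add: power2_norm_eq_inner inner_simps inner_commute)
  ultimately have "(norm (?z - ?z'))\<^sup>2 \<le> (y - y') \<bullet> (?z - ?z')"
    by simp
  also have "\<dots> \<le> norm (y - y') * norm (?z - ?z')"
    by (rule norm_cauchy_schwarz)
  finally show ?thesis
    by (cases "?z = ?z'") (auto simp: power2_eq_square)
qed

text \<open>The direction \<open>v\<close> is arbitrary and enters through its deviation from the true gradient only. Bound the
smooth part at \<open>z\<close> from above by smoothness and at the minimizer from below by strong convexity, both
expanded at \<open>x\<close>, and \<open>h\<close> by the variational inequality of the proximal point. Polarization turns the
inner product of \<open>x - z\<close> and \<open>z - xs\<close> into squared distances, and the surplus \<open>(norm (z - x))\<^sup>2\<close>
pays for the smoothness term because the step is at most \<open>1 / L\<close>.\<close>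

lemma prox_gradient_descent:
  fixes x v :: 'a
  assumes "\<eta> > 0" "\<eta> * L \<le> 1"
  defines "z \<equiv> prox \<eta> h (x - \<eta> *\<^sub>R v)"
  shows "(norm (z - xs))\<^sup>2 + 2 * \<eta> * gap z \<le>
     (1 - \<eta> * \<mu>) * (norm (x - xs))\<^sup>2 - 2 * \<eta> * ((v - grad smooth_part x) \<bullet> (z - xs))"
proof -
  let ?g = "grad smooth_part x"
  have "real_of_ereal (h z) - real_of_ereal (h xs) \<le> - ((x - \<eta> *\<^sub>R v - z) \<bullet> (xs - z)) / \<eta>"
    using prox_variational[OF assms(1) optimality(1), of "x - \<eta> *\<^sub>R v"] unfolding z_def by simp
  moreover have "smooth_part z - smooth_part xs \<le>
      (z - xs) \<bullet> ?g + L / 2 * (norm (z - x))\<^sup>2 - \<mu> / 2 * (norm (xs - x))\<^sup>2"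
    using smooth_part_upper[of z x] smooth_part_lower[of xs x] by (simp add: inner_diff_left)
  ultimately have "gap z \<le> - ((x - \<eta> *\<^sub>R v - z) \<bullet> (xs - z)) / \<eta>
      + ((z - xs) \<bullet> ?g + L / 2 * (norm (z - x))\<^sup>2 - \<mu> / 2 * (norm (xs - x))\<^sup>2)"
    by (simp add: gap_def)
  then have "2 * \<eta> * gap z \<le> 2 * \<eta> * (- ((x - \<eta> *\<^sub>R v - z) \<bullet> (xs - z)) / \<eta>
      + ((z - xs) \<bullet> ?g + L / 2 * (norm (z - x))\<^sup>2 - \<mu> / 2 * (norm (xs - x))\<^sup>2))"
    using assms(1) by (intro mult_left_mono) auto
  also have "\<dots> = - 2 * ((x - \<eta> *\<^sub>R v - z) \<bullet> (xs - z)) + 2 * \<eta> * ((z - xs) \<bullet> ?g)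
      + \<eta> * L * (norm (z - x))\<^sup>2 - \<eta> * \<mu> * (norm (xs - x))\<^sup>2"
    using assms(1) by (simp add: field_simps)
  also have "\<dots> \<le> - 2 * ((x - \<eta> *\<^sub>R v - z) \<bullet> (xs - z)) + 2 * \<eta> * ((z - xs) \<bullet> ?g)
      + (norm (z - x))\<^sup>2 - \<eta> * \<mu> * (norm (xs - x))\<^sup>2"
    using mult_right_mono[OF assms(2), of "(norm (z - x))\<^sup>2"] by simp
  also have "\<dots> = (1 - \<eta> * \<mu>) * (norm (x - xs))\<^sup>2 - (norm (z - xs))\<^sup>2
      - 2 * \<eta> * ((v - ?g) \<bullet> (z - xs))"
    by (simp add: power2_norm_eq_inner inner_simps inner_commute algebra_simps)
  finally show ?thesis
    by simp
qed

lemma sum_estimator_error: "(\<Sum>i=1..n. estimator i x w - grad smooth_part x) = 0"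
proof -
  have "(\<Sum>i=1..n. grad (f i) y) = real n *\<^sub>R grad smooth_part y" for y
    using n by (simp add: grad_smooth_part)
  then show ?thesis
    by (simp add: estimator_def sum_subtractf sum.distrib sum_constant_scaleR)
qed

text \<open>Summing the cocoercivity inequality produces the Bregman distance of the smooth part, which the
optimality gap dominates.\<close>

lemma gradient_variance_at_minimizer:
  assumes "h x \<noteq> \<infinity>"
  shows "(\<Sum>i=1..n. (norm (grad (f i) x - grad (f i) xs))\<^sup>2) \<le> real n * (2 * L * gap x)"
proof -
  have "(\<Sum>i=1..n. (norm (grad (f i) x - grad (f i) xs))\<^sup>2) \<le>
      (\<Sum>i=1..n. 2 * L * (f i x - f i xs - (x - xs) \<bullet> grad (f i) xs))"
  proof (intro sum_mono gradient_cocoercive L)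
    fix i x y assume "i \<in> {1..n}"
    then show "0 \<le> f i y - f i x - (y - x) \<bullet> grad (f i) x"
      using lower[of i y x] mu by (smt (verit) divide_nonneg_nonneg mult_nonneg_nonneg zero_le_power2)
  qed (rule upper)
  also have "\<dots> = 2 * L * (real n * (smooth_part x - smooth_part xs - (x - xs) \<bullet> grad smooth_part xs))"
    unfolding smooth_part_expansion using n by (simp add: sum_distrib_left[symmetric])
  also have "\<dots> \<le> 2 * L * (real n * gap x)"
    using smooth_gap_le_gap[OF assms] L by (intro mult_left_mono) auto
  finally show ?thesis
    by (simp add: algebra_simps)
qed

text \<open>The errors are \<open>u i - m\<close> with \<open>m\<close> the mean of the \<open>u i\<close>, so dropping the square of the mean bounds the
variance by the second moment of the gradient differences. These are split at the minimizer, which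
leads to one gap for \<open>x\<close> and one for \<open>w\<close>: the noise vanishes as both points approach the solution.\<close>

lemma estimator_variance:
  assumes "h x \<noteq> \<infinity>" "h w \<noteq> \<infinity>"
  shows "(\<Sum>i=1..n. (norm (estimator i x w - grad smooth_part x))\<^sup>2) \<le> real n * (4 * L * (gap x + gap w))"
proof -
  define u where "u = (\<lambda>i. grad (f i) x - grad (f i) w)"
  define m where "m = grad smooth_part x - grad smooth_part w"
  have sum_u: "(\<Sum>i=1..n. u i) = real n *\<^sub>R m"
    using n by (simp add: u_def m_def grad_smooth_part sum_subtractf algebra_simps)
  have "(\<Sum>i=1..n. (norm (estimator i x w - grad smooth_part x))\<^sup>2) = (\<Sum>i=1..n. (norm (u i - m))\<^sup>2)"
    by (simp add: estimator_def u_def m_def algebra_simps)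
  also have "\<dots> = (\<Sum>i=1..n. (norm (u i))\<^sup>2 - 2 * (u i \<bullet> m) + (norm m)\<^sup>2)"
    by (simp add: power2_norm_eq_inner inner_simps inner_commute algebra_simps)
  also have "\<dots> = (\<Sum>i=1..n. (norm (u i))\<^sup>2) - 2 * ((\<Sum>i=1..n. u i) \<bullet> m) + real n * (norm m)\<^sup>2"
    by (simp add: sum.distrib sum_subtractf sum_distrib_left inner_sum_left)
  also have "\<dots> = (\<Sum>i=1..n. (norm (u i))\<^sup>2) - real n * (norm m)\<^sup>2"
    unfolding sum_u by (simp add: power2_norm_eq_inner)
  also have "\<dots> \<le> (\<Sum>i=1..n. (norm (u i))\<^sup>2)"
    by simp
  also have "\<dots> \<le> (\<Sum>i=1..n. 2 * (norm (grad (f i) x - grad (f i) xs))\<^sup>2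
      + 2 * (norm (grad (f i) w - grad (f i) xs))\<^sup>2)"
  proof (rule sum_mono)
    fix i
    have "(norm (a - b))\<^sup>2 \<le> 2 * (norm a)\<^sup>2 + 2 * (norm b)\<^sup>2" for a b :: 'a
    proof -
      have "2 * (norm a)\<^sup>2 + 2 * (norm b)\<^sup>2 - (norm (a - b))\<^sup>2 = (norm (a + b))\<^sup>2"
        by (simp add: power2_norm_eq_inner inner_simps inner_commute)
      then show ?thesis
        by (smt (verit) zero_le_power2)
    qed
    from this[of "grad (f i) x - grad (f i) xs" "grad (f i) w - grad (f i) xs"]
    show "(norm (u i))\<^sup>2 \<le> 2 * (norm (grad (f i) x - grad (f i) xs))\<^sup>2
      + 2 * (norm (grad (f i) w - grad (f i) xs))\<^sup>2"
      by (simp add: u_def)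
  qed
  also have "\<dots> \<le> 2 * (real n * (2 * L * gap x)) + 2 * (real n * (2 * L * gap w))"
    unfolding sum.distrib sum_distrib_left[symmetric]
    by (intro add_mono mult_left_mono gradient_variance_at_minimizer assms) auto
  finally show ?thesis
    by (simp add: algebra_simps)
qed

text \<open>The error of the estimator is paired with the random point \<open>z i\<close>, so it does not average out at once.
Replacing \<open>z i\<close> by the proximal point \<open>zbar\<close> of the exact gradient step, which does not depend on the
sample, makes the pairing average to 0; nonexpansiveness bounds the cost of the replacement by the step size
times the squared error.\<close>

lemma prox_step_mean:
  fixes x w :: 'a
  assumes "\<eta> > 0" "\<eta> * L \<le> 1" and "h x \<noteq> \<infinity>" "h w \<noteq> \<infinity>"
  defines "z \<equiv> \<lambda>i. prox \<eta> h (x - \<eta> *\<^sub>R estimator i x w)"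
  shows "(\<Sum>i=1..n. (norm (z i - xs))\<^sup>2 + 2 * \<eta> * gap (z i)) / real n \<le>
     (1 - \<eta> * \<mu>) * (norm (x - xs))\<^sup>2 + 8 * L * \<eta>\<^sup>2 * (gap x + gap w)"
proof -
  define e where "e = (\<lambda>i. estimator i x w - grad smooth_part x)"
  define zbar where "zbar = prox \<eta> h (x - \<eta> *\<^sub>R grad smooth_part x)"
  have step: "(norm (z i - xs))\<^sup>2 + 2 * \<eta> * gap (z i) \<le>
      (1 - \<eta> * \<mu>) * (norm (x - xs))\<^sup>2 - 2 * \<eta> * (e i \<bullet> (zbar - xs)) + 2 * \<eta>\<^sup>2 * (norm (e i))\<^sup>2" for i
  proof -
    have "norm (z i - zbar) \<le> norm ((x - \<eta> *\<^sub>R estimator i x w) - (x - \<eta> *\<^sub>R grad smooth_part x))"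
      unfolding z_def zbar_def by (rule prox_nonexpansive[OF assms(1)])
    also have "\<dots> = norm (\<eta> *\<^sub>R e i)"
      unfolding e_def by (subst norm_minus_commute) (simp add: algebra_simps)
    finally have "norm (z i - zbar) \<le> \<eta> * norm (e i)"
      using assms(1) by simp
    then have "norm (e i) * norm (zbar - z i) \<le> norm (e i) * (\<eta> * norm (e i))"
      by (intro mult_left_mono) (simp_all add: norm_minus_commute)
    then have "e i \<bullet> (zbar - z i) \<le> \<eta> * (norm (e i))\<^sup>2"
      using norm_cauchy_schwarz[of "e i" "zbar - z i"] by (simp add: power2_eq_square algebra_simps)
    then have "\<eta> * (e i \<bullet> (zbar - z i)) \<le> \<eta> * (\<eta> * (norm (e i))\<^sup>2)"
      using assms(1) by (intro mult_left_mono) auto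
    moreover have "(norm (z i - xs))\<^sup>2 + 2 * \<eta> * gap (z i) \<le>
        (1 - \<eta> * \<mu>) * (norm (x - xs))\<^sup>2 - 2 * \<eta> * (e i \<bullet> (z i - xs))"
      unfolding z_def e_def by (rule prox_gradient_descent[OF assms(1,2)])
    ultimately show ?thesis
      by (simp add: inner_diff_right power2_eq_square algebra_simps)
  qed
  have "(\<Sum>i=1..n. (norm (z i - xs))\<^sup>2 + 2 * \<eta> * gap (z i)) \<le>
      (\<Sum>i=1..n. (1 - \<eta> * \<mu>) * (norm (x - xs))\<^sup>2 - 2 * \<eta> * (e i \<bullet> (zbar - xs)) + 2 * \<eta>\<^sup>2 * (norm (e i))\<^sup>2)"
    by (intro sum_mono step)
  also have "\<dots> = real n * ((1 - \<eta> * \<mu>) * (norm (x - xs))\<^sup>2)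
      - 2 * \<eta> * ((\<Sum>i=1..n. e i) \<bullet> (zbar - xs)) + 2 * \<eta>\<^sup>2 * (\<Sum>i=1..n. (norm (e i))\<^sup>2)"
    by (simp add: sum.distrib sum_subtractf sum_distrib_left inner_sum_left)
  also have "\<dots> = real n * ((1 - \<eta> * \<mu>) * (norm (x - xs))\<^sup>2) + 2 * \<eta>\<^sup>2 * (\<Sum>i=1..n. (norm (e i))\<^sup>2)"
    using sum_estimator_error[of x w] by (simp add: e_def)
  also have "\<dots> \<le> real n * ((1 - \<eta> * \<mu>) * (norm (x - xs))\<^sup>2) + 2 * \<eta>\<^sup>2 * (real n * (4 * L * (gap x + gap w)))"
    unfolding e_def by (intro add_left_mono mult_left_mono estimator_variance assms) auto
  also have "\<dots> = real n * ((1 - \<eta> * \<mu>) * (norm (x - xs))\<^sup>2 + 8 * L * \<eta>\<^sup>2 * (gap x + gap w))"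
    by (simp add: algebra_simps)
  finally show ?thesis
    using n by (simp add: field_simps)
qed

end

context smooth_finite_sum
begin

definition potential :: "real \<Rightarrow> real \<Rightarrow> 'a \<Rightarrow> 'a \<Rightarrow> real" where
  "potential p \<eta> x w = (norm (x - xs))\<^sup>2 + 10 * L / p * \<eta>\<^sup>2 * gap w + 2 * \<eta> * gap x"

lemma lyapunov_eq_potential:
  assumes "h x \<noteq> \<infinity>" "h w \<noteq> \<infinity>"
  shows "lyapunov (objective n f h) xs L p \<eta> (x, w) = ereal (potential p \<eta> x w)"
  by (simp add: lyapunov_def potential_def objective_gap assms)

text \<open>Starting outside the domain of \<open>h\<close> the claimed bound is infinite.\<close>

lemma lyapunov_infinite:
  assumes "h x = \<infinity>" and "0 < p" "0 < \<eta>"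
  shows "lyapunov (objective n f h) xs L p \<eta> (x, x) = \<infinity>"
proof -
  have "objective n f h x - objective n f h xs = \<infinity>"
    using ereal_h[OF optimality(1)] assms(1) by (cases "h xs") (auto simp: objective_def)
  then show ?thesis
    using assms L by (simp add: lyapunov_def)
qed

lemma potential_nonneg:
  "\<lbrakk>h x \<noteq> \<infinity>; h w \<noteq> \<infinity>; 0 < p; 0 < \<eta>\<rbrakk> \<Longrightarrow> 0 \<le> potential p \<eta> x w"
  using gap_nonneg[of x] gap_nonneg[of w] L by (simp add: potential_def)

text \<open>Refreshing the reference point with probability \<open>p\<close> adds \<open>10 * L * \<eta>\<^sup>2\<close> times the gap of \<open>x\<close>; with the
\<open>8 * L * \<eta>\<^sup>2\<close> from the variance this makes \<open>18 * L * \<eta>\<^sup>2\<close>, at most \<open>2 * \<eta> * (1 - \<eta> * \<mu>)\<close> by the step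
size condition. The gap of \<open>w\<close> keeps \<open>1 - p\<close> of its weight \<open>10 * L * \<eta>\<^sup>2 / p\<close> and receives
\<open>8 * L * \<eta>\<^sup>2\<close>, which is \<open>4 / 5 * p\<close> of the weight: the total factor is \<open>1 - p / 5\<close>.\<close>

lemma potential_contraction:
  fixes x w :: 'a
  assumes p: "0 < p" "p \<le> 1" and \<eta>: "0 < \<eta>" "\<eta> * L \<le> 1" "\<eta> * (18 * L + 2 * \<mu>) \<le> 2"
    and "h x \<noteq> \<infinity>" "h w \<noteq> \<infinity>"
  defines "z \<equiv> \<lambda>i. prox \<eta> h (x - \<eta> *\<^sub>R estimator i x w)"
  shows "(\<Sum>i=1..n. p * potential p \<eta> (z i) x + (1 - p) * potential p \<eta> (z i) w) / real n \<le>
     max (1 - \<eta> * \<mu>) (1 - p / 5) * potential p \<eta> x w"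
proof -
  define \<rho> where "\<rho> = max (1 - \<eta> * \<mu>) (1 - p / 5)"
  define c where "c = 10 * L / p * \<eta>\<^sup>2"
  have c: "0 \<le> c" "p * c = 10 * L * \<eta>\<^sup>2"
    using p L by (auto simp: c_def)
  have "(\<Sum>i=1..n. p * potential p \<eta> (z i) x + (1 - p) * potential p \<eta> (z i) w) / real n
      = (\<Sum>i=1..n. ((norm (z i - xs))\<^sup>2 + 2 * \<eta> * gap (z i)) + c * (p * gap x + (1 - p) * gap w)) / real n"
  proof -
    have "potential p \<eta> a b = (norm (a - xs))\<^sup>2 + c * gap b + 2 * \<eta> * gap a" for a b
      by (simp add: potential_def c_def)
    then show ?thesis
      by (simp add: algebra_simps)
  qed
  also have "\<dots> = (\<Sum>i=1..n. (norm (z i - xs))\<^sup>2 + 2 * \<eta> * gap (z i)) / real n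
      + c * (p * gap x + (1 - p) * gap w)"
    unfolding sum.distrib[of _ "\<lambda>i. c * (p * gap x + (1 - p) * gap w)"] using n
    by (simp add: add_divide_distrib)
  also have "\<dots> \<le> (1 - \<eta> * \<mu>) * (norm (x - xs))\<^sup>2 + 8 * L * \<eta>\<^sup>2 * (gap x + gap w)
      + c * (p * gap x + (1 - p) * gap w)"
    using prox_step_mean[OF \<eta>(1,2) assms(6,7)] by (simp add: z_def)
  also have "\<dots> = (1 - \<eta> * \<mu>) * (norm (x - xs))\<^sup>2 + c * ((1 - p / 5) * gap w)
      + (18 * L * \<eta>\<^sup>2) * gap x"
  proof -
    have "8 * L * \<eta>\<^sup>2 = 4 / 5 * (p * c)"
      using c by simp
    moreover have "18 * L * \<eta>\<^sup>2 = 9 / 5 * (p * c)"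
      using c by simp
    ultimately show ?thesis
      by (simp only:) (simp add: field_simps)
  qed
  also have "\<dots> \<le> \<rho> * (norm (x - xs))\<^sup>2 + c * (\<rho> * gap w) + (2 * \<eta> * \<rho>) * gap x"
  proof (intro add_mono mult_left_mono mult_right_mono)
    have "\<eta> * (\<eta> * (18 * L + 2 * \<mu>)) \<le> \<eta> * 2"
      using \<eta> by (intro mult_left_mono) auto
    then have "18 * L * \<eta>\<^sup>2 \<le> 2 * \<eta> * (1 - \<eta> * \<mu>)"
      by (simp add: algebra_simps power2_eq_square)
    also have "\<dots> \<le> 2 * \<eta> * \<rho>"
      using \<eta> by (intro mult_left_mono) (auto simp: \<rho>_def)
    finally show "18 * L * \<eta>\<^sup>2 \<le> 2 * \<eta> * \<rho>" .
  qed (use assms c in \<open>auto simp: \<rho>_def gap_nonneg\<close>)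
  also have "\<dots> = \<rho> * potential p \<eta> x w"
    by (simp add: potential_def c_def algebra_simps)
  finally show ?thesis
    by (simp add: \<rho>_def)
qed

lemma lsvrg_Suc:
  assumes "lsvrg n f h (\<lambda>_. \<eta>) x0 is bs k = (x, w)"
  shows "lsvrg n f h (\<lambda>_. \<eta>) x0 is bs (Suc k) =
     (prox \<eta> h (x - \<eta> *\<^sub>R estimator (is k) x w), if bs k then x else w)"
  using assms by (simp add: estimator_def smooth_part_def)

lemma lsvrg_finite:
  assumes "h x0 \<noteq> \<infinity>" and "\<eta> > 0" and "lsvrg n f h (\<lambda>_. \<eta>) x0 is bs k = (x, w)"
  shows "h x \<noteq> \<infinity> \<and> h w \<noteq> \<infinity>"
  using assms(3)
proof (induction k arbitrary: x w)
  case 0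
  then show ?case using assms(1) by auto
next
  case (Suc k)
  obtain x' w' where st: "lsvrg n f h (\<lambda>_. \<eta>) x0 is bs k = (x', w')"
    by force
  with Suc.IH[OF st] Suc.prems lsvrg_Suc[OF st] show ?case
    by (auto simp: prox_finite[OF assms(2)] simp del: lsvrg.simps split: if_splits)
qed

end

section \<open>Averaging over the randomness\<close>

text \<open>This is Tonelli's theorem for the product of the two distributions. On countable types every
integrand is measurable.\<close>

lemma (in prob_space) nn_integral_indep_countable:
  fixes X Y :: "'a \<Rightarrow> 'b::countable" and g :: "'b \<Rightarrow> 'b \<Rightarrow> ennreal"
  assumes "indep_var (count_space UNIV) X (count_space UNIV) Y"
  shows "(\<integral>\<^sup>+ \<omega>. g (X \<omega>) (Y \<omega>) \<partial>M) = (\<integral>\<^sup>+ \<omega>. (\<integral>\<^sup>+ \<omega>'. g (X \<omega>) (Y \<omega>') \<partial>M) \<partial>M)"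
proof -
  let ?C = "count_space (UNIV :: 'b set)"
  have X: "X \<in> measurable M ?C" and Y: "Y \<in> measurable M ?C"
    using assms by (auto dest: indep_var_rv1 indep_var_rv2)
  interpret Y: prob_space "distr M ?C Y"
    by (rule prob_space_distr[OF Y])
  have g: "case_prod g \<in> borel_measurable (?C \<Otimes>\<^sub>M ?C)"
    by (subst pair_measure_countable) auto
  have XY: "(\<lambda>\<omega>. (X \<omega>, Y \<omega>)) \<in> measurable M (?C \<Otimes>\<^sub>M ?C)"
    using X Y by measurable
  have "(\<integral>\<^sup>+ \<omega>. g (X \<omega>) (Y \<omega>) \<partial>M) = (\<integral>\<^sup>+ xy. case_prod g xy \<partial>distr M (?C \<Otimes>\<^sub>M ?C) (\<lambda>\<omega>. (X \<omega>, Y \<omega>)))"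
    by (subst nn_integral_distr[OF XY]) (use g in auto)
  also have "\<dots> = (\<integral>\<^sup>+ xy. case_prod g xy \<partial>(distr M ?C X \<Otimes>\<^sub>M distr M ?C Y))"
    using indep_var_distribution_eq[of ?C X ?C Y] assms by simp
  also have "\<dots> = (\<integral>\<^sup>+ x. \<integral>\<^sup>+ y. g x y \<partial>distr M ?C Y \<partial>distr M ?C X)"
    by (subst Y.nn_integral_fst[symmetric]) (use g in \<open>auto cong: measurable_cong_sets\<close>)
  also have "\<dots> = (\<integral>\<^sup>+ \<omega>. (\<integral>\<^sup>+ \<omega>'. g (X \<omega>) (Y \<omega>') \<partial>M) \<partial>M)"
    by (simp add: nn_integral_distr[OF X] nn_integral_distr[OF Y])
  finally show ?thesis .
qed

text \<open>The samples seen before iteration \<open>k\<close>. Histories form a countable type, so every function of the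
history is measurable; the state of the algorithm is such a function.\<close>

definition history :: "(nat \<Rightarrow> 's \<Rightarrow> nat) \<Rightarrow> (nat \<Rightarrow> 's \<Rightarrow> bool) \<Rightarrow> nat \<Rightarrow> 's \<Rightarrow> (nat \<times> bool) list" where
  "history I B k \<omega> = map (\<lambda>j. (I j \<omega>, B j \<omega>)) [0..<k]"

lemma measurable_pair_countable:
  fixes X :: "'s \<Rightarrow> 'b::countable" and Y :: "'s \<Rightarrow> 'c::countable"
  assumes "X \<in> measurable N (count_space UNIV)" and "Y \<in> measurable N (count_space UNIV)"
  shows "(\<lambda>\<omega>. (X \<omega>, Y \<omega>)) \<in> measurable N (count_space UNIV)"
  by (rule measurable_compose_countable[where f = "\<lambda>x \<omega>. (x, Y \<omega>)", OF _ assms(1)])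
    (rule measurable_compose[OF assms(2)], simp)

lemma measurable_history:
  assumes "\<And>j. j < k \<Longrightarrow> I j \<in> measurable N (count_space UNIV)"
    and "\<And>j. j < k \<Longrightarrow> B j \<in> measurable N (count_space UNIV)"
  shows "history I B k \<in> measurable N (count_space UNIV)"
  using assms
proof (induction k)
  case (Suc k)
  have IB: "(\<lambda>\<omega>. (I k \<omega>, B k \<omega>)) \<in> measurable N (count_space UNIV)"
    using Suc.prems by (intro measurable_pair_countable) auto
  have "(\<lambda>\<omega>. history I B k \<omega> @ [(I k \<omega>, B k \<omega>)]) \<in> measurable N (count_space UNIV)"
    by (rule measurable_compose_countable[where f = "\<lambda>l \<omega>. l @ [(I k \<omega>, B k \<omega>)]"])
      (use Suc in \<open>auto intro: measurable_compose[OF IB]\<close>)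
  then show ?case
    by (simp add: history_def[abs_def])
qed (simp add: history_def[abs_def])

lemma lsvrg_randomness_measurable:
  assumes "lsvrg_randomness M n p I B"
  shows "I j \<in> measurable M (count_space UNIV)" and "B j \<in> measurable M (count_space UNIV)"
proof -
  interpret prob_space M
    using assms by (simp add: lsvrg_randomness_def)
  have "random_variable (count_space UNIV)
      (case_sum (\<lambda>k \<omega>. Inl (I k \<omega>)) (\<lambda>k \<omega>. Inr (B k \<omega>)) i)" for i
    using assms by (auto simp: lsvrg_randomness_def indep_vars_def)
  from measurable_compose[OF this[of "Inl j"], of projl] measurable_compose[OF this[of "Inr j"], of projr]
  show "I j \<in> measurable M (count_space UNIV)" "B j \<in> measurable M (count_space UNIV)"
    by simp_all
qed

text \<open>The index and the coin of iteration \<open>k\<close> may be averaged out one after the other with the history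
held fixed: the coin is independent of the history together with the index, and the index is
independent of the history.\<close>

lemma nn_integral_next_sample:
  fixes g :: "(nat \<times> bool) list \<Rightarrow> nat \<Rightarrow> bool \<Rightarrow> ennreal"
  assumes "lsvrg_randomness M n p I B"
  shows "(\<integral>\<^sup>+ \<omega>. g (history I B k \<omega>) (I k \<omega>) (B k \<omega>) \<partial>M) =
     (\<integral>\<^sup>+ \<omega>. (\<integral>\<^sup>+ i. (\<integral>\<^sup>+ b. g (history I B k \<omega>) i b \<partial>bernoulli_pmf p) \<partial>pmf_of_set {1..n}) \<partial>M)"
proof -
  interpret prob_space M
    using assms by (simp add: lsvrg_randomness_def)
  define X where "X = case_sum (\<lambda>k \<omega>. Inl (I k \<omega>)) (\<lambda>k \<omega>. Inr (B k \<omega>))"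
  have ind: "indep_vars (\<lambda>_. count_space UNIV) X UNIV"
    and I: "distr M (count_space UNIV) (I k) = pmf_of_set {1..n}"
    and B: "distr M (count_space UNIV) (B k) = bernoulli_pmf p"
    using assms by (simp_all add: lsvrg_randomness_def X_def)
  have rv: "I j \<in> measurable M (count_space UNIV)" "B j \<in> measurable M (count_space UNIV)" for j
    using assms by (auto intro: lsvrg_randomness_measurable)
  define past where "past = (Inl ` {..<k} \<union> Inr ` {..<k} :: (nat + nat) set)"
  define I' where "I' = (\<lambda>j (\<xi> :: nat + nat \<Rightarrow> nat + bool). projl (\<xi> (Inl j)))"
  define B' where "B' = (\<lambda>j (\<xi> :: nat + nat \<Rightarrow> nat + bool). projr (\<xi> (Inr j)))"
  have I': "I' j \<in> measurable (PiM A (\<lambda>_. count_space UNIV)) (count_space UNIV)" if "Inl j \<in> A" for j A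
    unfolding I'_def by (rule measurable_compose[OF measurable_component_singleton[OF that]]) simp
  have B': "B' j \<in> measurable (PiM A (\<lambda>_. count_space UNIV)) (count_space UNIV)" if "Inr j \<in> A" for j A
    unfolding B'_def by (rule measurable_compose[OF measurable_component_singleton[OF that]]) simp
  have hist: "history I' B' k (restrict (\<lambda>i. X i \<omega>) A) = history I B k \<omega>" if "past \<subseteq> A" for A \<omega>
    using that by (auto simp: history_def I'_def B'_def X_def past_def subset_iff image_iff)
  \<comment> \<open>The injections into a sum type give the two variables the common value type of an independent pair.\<close>
  have "indep_var (count_space UNIV) (\<lambda>\<omega>. Inl (history I B k \<omega>) :: _ + nat)
      (count_space UNIV) (\<lambda>\<omega>. Inr (I k \<omega>))"
  proof -
    have "indep_var (count_space UNIV)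
          ((\<lambda>\<xi>. Inl (history I' B' k \<xi>) :: _ + nat) \<circ> (\<lambda>\<omega>. restrict (\<lambda>i. X i \<omega>) past))
        (count_space UNIV) ((\<lambda>\<xi>. Inr (I' k \<xi>)) \<circ> (\<lambda>\<omega>. restrict (\<lambda>i. X i \<omega>) {Inl k}))"
      by (intro indep_var_compose[OF indep_var_restrict[OF ind]]
          measurable_compose[OF measurable_history] measurable_compose[OF I'] I' B')
        (auto simp: past_def)
    then show ?thesis
      by (simp add: comp_def hist) (simp add: I'_def X_def)
  qed
  from nn_integral_indep_countable[OF this, of "\<lambda>l i. g' (projl l) (projr i)" for g']
  have index: "(\<integral>\<^sup>+ \<omega>. g' (history I B k \<omega>) (I k \<omega>) \<partial>M) =
      (\<integral>\<^sup>+ \<omega>. \<integral>\<^sup>+ i. g' (history I B k \<omega>) i \<partial>pmf_of_set {1..n} \<partial>M)" for g'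
    by (simp add: I[symmetric, unfolded One_nat_def] nn_integral_distr[OF rv(1)])
  have "indep_var (count_space UNIV) (\<lambda>\<omega>. Inl (history I B k \<omega>, I k \<omega>) :: _ + bool)
      (count_space UNIV) (\<lambda>\<omega>. Inr (B k \<omega>))"
  proof -
    have "indep_var (count_space UNIV)
          ((\<lambda>\<xi>. Inl (history I' B' k \<xi>, I' k \<xi>) :: _ + bool) \<circ>
            (\<lambda>\<omega>. restrict (\<lambda>i. X i \<omega>) (insert (Inl k) past)))
        (count_space UNIV) ((\<lambda>\<xi>. Inr (B' k \<xi>)) \<circ> (\<lambda>\<omega>. restrict (\<lambda>i. X i \<omega>) {Inr k}))"
      by (intro indep_var_compose[OF indep_var_restrict[OF ind]]
          measurable_compose[OF measurable_pair_countable] measurable_compose[OF B']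
          measurable_history I' B') (auto simp: past_def)
    then show ?thesis
      by (simp add: comp_def hist subset_insertI) (simp add: I'_def B'_def X_def)
  qed
  from nn_integral_indep_countable[OF this, of "\<lambda>l b. (case projl l of (l, i) \<Rightarrow> g l i (projr b))"]
  have "(\<integral>\<^sup>+ \<omega>. g (history I B k \<omega>) (I k \<omega>) (B k \<omega>) \<partial>M) =
      (\<integral>\<^sup>+ \<omega>. \<integral>\<^sup>+ b. g (history I B k \<omega>) (I k \<omega>) b \<partial>bernoulli_pmf p \<partial>M)"
    by (simp add: B[symmetric] nn_integral_distr[OF rv(2)])
  also note index
  finally show ?thesis .
qed

lemma lsvrg_cong:
  assumes "\<And>j. j < k \<Longrightarrow> is j = is' j" and "\<And>j. j < k \<Longrightarrow> bs j = bs' j"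
  shows "lsvrg n f h \<eta> x0 is bs k = lsvrg n f h \<eta> x0 is' bs' k"
  using assms by (induction k) (auto simp: Let_def split: prod.splits)

lemma lsvrg_history:
  "lsvrg n f h \<eta> x0 (\<lambda>j. I j \<omega>) (\<lambda>j. B j \<omega>) k =
     lsvrg n f h \<eta> x0 (\<lambda>j. fst (history I B k \<omega> ! j)) (\<lambda>j. snd (history I B k \<omega> ! j)) k"
  by (rule lsvrg_cong) (auto simp: history_def)

text \<open>Conditionally on the history one iteration contracts the potential on average, so the expectation
contracts in every iteration.\<close>

lemma (in smooth_finite_sum) nn_integral_potential:
  assumes rand: "lsvrg_randomness M n p I B"
    and p: "0 < p" "p \<le> 1" and \<eta>: "0 < \<eta>" "\<eta> * L \<le> 1" "\<eta> * (18 * L + 2 * \<mu>) \<le> 2"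
    and x0: "h x0 \<noteq> \<infinity>"
  defines "st \<equiv> \<lambda>k \<omega>. lsvrg n f h (\<lambda>_. \<eta>) x0 (\<lambda>j. I j \<omega>) (\<lambda>j. B j \<omega>) k"
  shows "(\<integral>\<^sup>+ \<omega>. ennreal (case_prod (potential p \<eta>) (st k \<omega>)) \<partial>M) \<le>
     ennreal (max (1 - \<eta> * \<mu>) (1 - p / 5) ^ k * potential p \<eta> x0 x0)"
proof (induction k)
  case 0
  interpret prob_space M
    using rand by (simp add: lsvrg_randomness_def)
  show ?case
    by (simp add: st_def emeasure_space_1)
next
  case (Suc k)
  define \<rho> where "\<rho> = max (1 - \<eta> * \<mu>) (1 - p / 5)"
  have "0 \<le> \<rho>"
    using p by (simp add: \<rho>_def)
  define V where "V = potential p \<eta>"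
  define s where "s = (\<lambda>l. lsvrg n f h (\<lambda>_. \<eta>) x0 (\<lambda>j. fst (l ! j)) (\<lambda>j. snd (l ! j)) k)"
  define g where "g = (\<lambda>l i b. case s l of (x, w) \<Rightarrow>
      ennreal (V (prox \<eta> h (x - \<eta> *\<^sub>R estimator i x w)) (if b then x else w)))"
  have s: "st k \<omega> = s (history I B k \<omega>)" for \<omega>
    unfolding st_def s_def by (rule lsvrg_history)
  have mean: "(\<integral>\<^sup>+ i. (\<integral>\<^sup>+ b. g l i b \<partial>bernoulli_pmf p) \<partial>pmf_of_set {1..n}) \<le>
      ennreal \<rho> * ennreal (case_prod V (s l))" for l
  proof -
    obtain x w where xw: "s l = (x, w)"
      by force
    then have fin: "h x \<noteq> \<infinity>" "h w \<noteq> \<infinity>"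
      using lsvrg_finite[OF x0 \<eta>(1)] unfolding s_def by blast+
    define z where "z = (\<lambda>i. prox \<eta> h (x - \<eta> *\<^sub>R estimator i x w))"
    have V: "0 \<le> V (z i) x" "0 \<le> V (z i) w" for i
      unfolding V_def z_def by (intro potential_nonneg prox_finite p \<eta> fin)+
    have "(\<integral>\<^sup>+ b. g l i b \<partial>bernoulli_pmf p) = ennreal (p * V (z i) x + (1 - p) * V (z i) w)" for i
      using p V by (simp add: g_def xw z_def ennreal_mult' ennreal_plus mult.commute)
    then have "(\<integral>\<^sup>+ i. (\<integral>\<^sup>+ b. g l i b \<partial>bernoulli_pmf p) \<partial>pmf_of_set {1..n}) =
        (\<Sum>i=1..n. ennreal (p * V (z i) x + (1 - p) * V (z i) w)) / ennreal (real n)"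
      using n by (simp add: nn_integral_pmf_of_set ennreal_of_nat_eq_real_of_nat)
    also have "\<dots> = ennreal ((\<Sum>i=1..n. p * V (z i) x + (1 - p) * V (z i) w) / real n)"
    proof -
      have "0 \<le> p * V (z i) x + (1 - p) * V (z i) w" for i
        using p V by (intro add_nonneg_nonneg mult_nonneg_nonneg) auto
      then show ?thesis
        using n by (subst sum_ennreal) (auto intro!: divide_ennreal sum_nonneg)
    qed
    also have "\<dots> \<le> ennreal (\<rho> * V x w)"
      unfolding V_def z_def \<rho>_def by (intro ennreal_leI potential_contraction p \<eta> fin)
    finally show ?thesis
      using \<open>0 \<le> \<rho>\<close> by (simp add: xw ennreal_mult')
  qed
  have "(\<integral>\<^sup>+ \<omega>. ennreal (case_prod V (st (Suc k) \<omega>)) \<partial>M) =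
      (\<integral>\<^sup>+ \<omega>. g (history I B k \<omega>) (I k \<omega>) (B k \<omega>) \<partial>M)"
  proof (rule nn_integral_cong)
    fix \<omega>
    obtain x w where xw: "st k \<omega> = (x, w)"
      by force
    then have "s (history I B k \<omega>) = (x, w)"
      using s by simp
    then show "ennreal (case_prod V (st (Suc k) \<omega>)) = g (history I B k \<omega>) (I k \<omega>) (B k \<omega>)"
      using lsvrg_Suc[OF xw[unfolded st_def]] by (simp add: st_def g_def del: lsvrg.simps)
  qed
  also have "\<dots> = (\<integral>\<^sup>+ \<omega>. (\<integral>\<^sup>+ i. (\<integral>\<^sup>+ b. g (history I B k \<omega>) i b \<partial>bernoulli_pmf p) \<partial>pmf_of_set {1..n}) \<partial>M)"
    by (rule nn_integral_next_sample[OF rand])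
  also have "\<dots> \<le> (\<integral>\<^sup>+ \<omega>. ennreal \<rho> * ennreal (case_prod V (st k \<omega>)) \<partial>M)"
    unfolding s by (intro nn_integral_mono mean)
  also have "\<dots> = ennreal \<rho> * (\<integral>\<^sup>+ \<omega>. ennreal (case_prod V (st k \<omega>)) \<partial>M)"
  proof (rule nn_integral_cmult)
    show "(\<lambda>\<omega>. ennreal (case_prod V (st k \<omega>))) \<in> borel_measurable M"
      unfolding s using lsvrg_randomness_measurable[OF rand]
      by (intro measurable_compose[OF measurable_history]) auto
  qed
  also have "\<dots> \<le> ennreal \<rho> * ennreal (\<rho> ^ k * V x0 x0)"
    using Suc.IH by (intro mult_left_mono) (auto simp: V_def \<rho>_def)
  also have "\<dots> = ennreal (\<rho> ^ Suc k * V x0 x0)"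
    using \<open>0 \<le> \<rho>\<close> by (simp add: ennreal_mult'[symmetric] mult.assoc)
  finally show ?case
    by (simp add: V_def \<rho>_def)
qed

theorem theorem4p5:
  fixes f :: "nat \<Rightarrow> real^'d \<Rightarrow> real"
    and h :: "real^'d \<Rightarrow> ereal"
    and x\<^sub>0 x\<^sub>s :: "real^'d"
    and \<mu> L p \<eta> :: real
    and n k :: nat
    and M :: "'s measure"
    and I :: "nat \<Rightarrow> 's \<Rightarrow> nat"
    and B :: "nat \<Rightarrow> 's \<Rightarrow> bool"
  assumes "n \<ge> 1"
    and "\<And>i. i \<in> {1..n} \<Longrightarrow> twice_cont_differentiable (f i)"
    and "\<mu> > 0" and "L > 0"
    and "\<And>S x. S \<subseteq> {1..n} \<Longrightarrow> S \<noteq> {} \<Longrightarrow>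
           mat \<mu> \<preceq> hessian (avg f S) x \<and> hessian (avg f S) x \<preceq> mat L"
    and "proper_fun h" and "convex_fun h" and "lower_semicont h"
    and "unique_minimizer (objective n f h) x\<^sub>s"
    and "0 < p" and "p < 1"
    and "0 < \<eta>" and "\<eta> \<le> min (1 / L) (2 / (18 * L + 2 * \<mu>))"
    and "lsvrg_randomness M n p I B"
  shows "expect M (\<lambda>\<omega>. lyapunov (objective n f h) x\<^sub>s L p \<eta>
             (lsvrg n f h (\<lambda>_. \<eta>) x\<^sub>0 (\<lambda>j. I j \<omega>) (\<lambda>j. B j \<omega>) k))
         \<le> ereal (max (1 - \<eta> * \<mu>) (1 - p / 5) ^ k)
             * lyapunov (objective n f h) x\<^sub>s L p \<eta> (x\<^sub>0, x\<^sub>0)"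
proof -
  let ?F = "objective n f h"
  let ?\<rho> = "max (1 - \<eta> * \<mu>) (1 - p / 5)"
  have hess: "mat \<mu> \<preceq> hessian (f i) x" "hessian (f i) x \<preceq> mat L" if "i \<in> {1..n}" for i x
  proof -
    have "avg f {i} = f i"
      by (simp add: avg_def[abs_def])
    then show "mat \<mu> \<preceq> hessian (f i) x" "hessian (f i) x \<preceq> mat L"
      using assms(5)[of "{i}" x] that by auto
  qed
  interpret smooth_finite_sum n f h \<mu> L x\<^sub>s
  proof
    fix i x y assume i: "i \<in> {1..n}"
    show "GDERIV (f i) x :> grad (f i) x"
      using assms(2)[OF i] by (intro differentiable_GDERIV_grad) (simp add: twice_cont_differentiable_def)
    obtain z where z: "f i y - f i x - (y - x) \<bullet> grad (f i) x = (y - x) \<bullet> (hessian (f i) z *v (y - x)) / 2"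
      using second_order_expansion[OF assms(2)[OF i]] .
    show "\<mu> / 2 * (norm (y - x))\<^sup>2 \<le> f i y - f i x - (y - x) \<bullet> grad (f i) x"
      and "f i y - f i x - (y - x) \<bullet> grad (f i) x \<le> L / 2 * (norm (y - x))\<^sup>2"
      using quadratic_form_bounds[OF hess[OF i], of "y - x" z] z by auto
  qed (use assms in \<open>auto simp: unique_minimizer_def\<close>)
  have \<eta>: "0 < \<eta>" "\<eta> * L \<le> 1" "\<eta> * (18 * L + 2 * \<mu>) \<le> 2"
  proof -
    have "\<eta> \<le> 1 / L" "\<eta> \<le> 2 / (18 * L + 2 * \<mu>)"
      using assms(13) by auto
    moreover have "0 < 18 * L + 2 * \<mu>"
      using assms(3,4) by simp
    ultimately show "0 < \<eta>" "\<eta> * L \<le> 1" "\<eta> * (18 * L + 2 * \<mu>) \<le> 2"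
      using assms(4,12) by (simp_all only: pos_le_divide_eq)
  qed
  have \<rho>: "0 < ?\<rho>"
    using \<open>p < 1\<close> by (simp add: less_max_iff_disj)
  show ?thesis
  proof (cases "h x\<^sub>0 = \<infinity>")
    case True
    have "lyapunov ?F x\<^sub>s L p \<eta> (x\<^sub>0, x\<^sub>0) = \<infinity>"
      by (rule lyapunov_infinite[OF True \<open>0 < p\<close> \<eta>(1)])
    then show ?thesis
      using \<rho> by auto
  next
    case False
    let ?st = "\<lambda>\<omega>. lsvrg n f h (\<lambda>_. \<eta>) x\<^sub>0 (\<lambda>j. I j \<omega>) (\<lambda>j. B j \<omega>) k"
    have lyap: "lyapunov ?F x\<^sub>s L p \<eta> (?st \<omega>) = ereal (case_prod (potential p \<eta>) (?st \<omega>))" for \<omega>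
    proof -
      obtain x w where xw: "?st \<omega> = (x, w)"
        by force
      with lsvrg_finite[OF False \<eta>(1) xw] show ?thesis
        by (simp add: lyapunov_eq_potential)
    qed
    have "expect M (\<lambda>\<omega>. lyapunov ?F x\<^sub>s L p \<eta> (?st \<omega>)) =
        enn2ereal (\<integral>\<^sup>+ \<omega>. ennreal (case_prod (potential p \<eta>) (?st \<omega>)) \<partial>M)"
      by (simp add: expect_def lyap flip: ennreal.abs_eq)
    also have "\<dots> \<le> enn2ereal (ennreal (?\<rho> ^ k * potential p \<eta> x\<^sub>0 x\<^sub>0))"
      using nn_integral_potential[OF assms(14) \<open>0 < p\<close> less_imp_le[OF \<open>p < 1\<close>] \<eta> False]
      by (simp add: less_eq_ennreal.rep_eq)
    also have "\<dots> = ereal (?\<rho> ^ k * potential p \<eta> x\<^sub>0 x\<^sub>0)"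
      using \<rho> potential_nonneg[OF False False \<open>0 < p\<close> \<eta>(1)] by (intro enn2ereal_ennreal) simp
    also have "\<dots> = ereal (?\<rho> ^ k) * lyapunov ?F x\<^sub>s L p \<eta> (x\<^sub>0, x\<^sub>0)"
      by (simp add: lyapunov_eq_potential False)
    finally show ?thesis .
  qed
qed

end
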